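(* Let $r\geq 2$ and $1\leq i\leq r$ be integers. Then $\mathcal{B}_{r,i}=\mathcal{D}_{r,i}$.
   Context: A partition $\lambda=(\lambda_1,\dots,\lambda_s)$ is a non-increasing finite sequence of positive integers (the empty partition has $s=0$); row $m$ of its Young diagram (counted from the top) has $\lambda_m$ boxes. Durfee dissections. For a (possibly empty) partition $\mu=(\mu_1,\dots,\mu_t)$ let $\mathrm{sq}(\mu)=\max\{d\geq 0: d\leq t,\ \mu_d\geq d\}$ (side of its Durfee square, the largest $d\times d$ square in the top-left corner of the diagram) and $\mathrm{rect}(\mu)=\max\{h\geq 0: h\leq t,\ \mu_h\geq h+1\}$ (height of its horizontal Durfee rectangle, the largest rectangle with $h$ rows and $h+1$ columns in the top-left corner; $h=0$ is allowed). For an integer $k\geq 0$, the $k$-Durfee dissection of $\lambda$ is given by $\mu^{(0)}=\lambda$ and, for $j\geq1$, $c_j=\mathrm{rect}(\mu^{(j-1)})$ if $j\leq k$, $c_j=\mathrm{sq}(\mu^{(j-1)})$ if $j>k$, and $\mu^{(j)}$ is $\mu^{(j-1)}$ with its first $c_j$ parts deleted. $\mathcal{D}_{r,i}$ is the set of partitions $\lambda$ for which, in the $(r-i)$-Durfee dissection, $\mu^{(r-1)}$ is empty (i.e. $r-i$ successive horizontal Durfee rectangles followed by $i-1$ successive Durfee squares exhaust all rows). Bottom dissections. For a nonempty partition $\nu=(\nu_1,\dots,\nu_t)$, removing its bottom square (side $\nu_t$, bottom edge on the bottom of the diagram) means deleting its last $\min(\nu_t,t)$ parts, and removing its bottom rectangle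 (width $\nu_t$, height $\nu_t-1$) means deleting its last $\min(\nu_t-1,t)$ parts; on the empty partition both operations do nothing. For $k\geq0$, the $k$-bottom dissection of $\lambda$ is given by $\nu^{(0)}=\lambda$ and $\nu^{(j)}$ obtained from $\nu^{(j-1)}$ by removing its bottom square if $j\leq k$ and its bottom rectangle if $j>k$. $\mathcal{B}_{r,i}$ is the set of partitions $\lambda$ for which, in the $(i-1)$-bottom dissection, $\nu^{(r-1)}$ is empty. *)

theory Defs
  imports Main
begin

definition is_partition :: "nat list \<Rightarrow> bool" where
  "is_partition lam \<longleftrightarrow> sorted_wrt (\<ge>) lam \<and> (\<forall>x\<in>set lam. 0 < x)"

(* Lists are indexed from 0, so the part mu_d is mu ! (d - 1); the case d = 0 (resp. h = 0)
   is always admitted, so the maxima below are over nonempty finite sets. *)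

definition durfee_sq :: "nat list \<Rightarrow> nat" where
  "durfee_sq mu = Max {d. d \<le> length mu \<and> (1 \<le> d \<longrightarrow> d \<le> mu ! (d - 1))}"

definition durfee_rect :: "nat list \<Rightarrow> nat" where
  "durfee_rect mu = Max {h. h \<le> length mu \<and> (1 \<le> h \<longrightarrow> h + 1 \<le> mu ! (h - 1))}"

(* durfee_dissection k lam j is the partition mu^(j) of the k-Durfee dissection of lam. *)
fun durfee_dissection :: "nat \<Rightarrow> nat list \<Rightarrow> nat \<Rightarrow> nat list" where
  "durfee_dissection k lam 0 = lam"
| "durfee_dissection k lam (Suc j) =
     (let mu = durfee_dissection k lam j;
          c = (if Suc j \<le> k then durfee_rect mu else durfee_sq mu)
      in drop c mu)"

definition durfee_set :: "nat \<Rightarrow> nat \<Rightarrow> nat list set" where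
  "durfee_set r i = {lam. is_partition lam \<and> durfee_dissection (r - i) lam (r - 1) = []}"

definition remove_bottom_square :: "nat list \<Rightarrow> nat list" where
  "remove_bottom_square nu =
     (if nu = [] then [] else take (length nu - min (last nu) (length nu)) nu)"

definition remove_bottom_rect :: "nat list \<Rightarrow> nat list" where
  "remove_bottom_rect nu =
     (if nu = [] then [] else take (length nu - min (last nu - 1) (length nu)) nu)"

(* bottom_dissection k lam j is the partition nu^(j) of the k-bottom dissection of lam. *)
fun bottom_dissection :: "nat \<Rightarrow> nat list \<Rightarrow> nat \<Rightarrow> nat list" where
  "bottom_dissection k lam 0 = lam"
| "bottom_dissection k lam (Suc j) =
     (let nu = bottom_dissection k lam j
      in if Suc j \<le> k then remove_bottom_square nu else remove_bottom_rect nu)"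

definition bottom_set :: "nat \<Rightarrow> nat \<Rightarrow> nat list set" where
  "bottom_set r i = {lam. is_partition lam \<and> bottom_dissection (i - 1) lam (r - 1) = []}"

end

theory Submission
  imports Defs
begin

text \<open>
  Both conditions say that the rows of \<open>\<lambda>\<close> can be cut, from top to bottom, into \<open>r - 1\<close>
  (possibly empty) blocks of consecutive rows, such that in each of the first \<open>r - i\<close>
  blocks, if nonempty, the shortest row exceeds the height, and in each of the last
  \<open>i - 1\<close> blocks, if nonempty, it is at least the
  height. The Durfee dissection makes the blocks greedily maximal from the top, the bottom
  dissection from the bottom. Either greedy strategy succeeds whenever some cutting exists, since
  the existence of a cutting is inherited when top rows or bottom rows are deleted.
\<close>

text \<open>\<open>e = 1\<close> encodes the rectangle condition and \<open>e = 0\<close> the square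
  condition; in a non-increasing list \<open>last s\<close> is the shortest row.\<close>

definition is_block :: "nat \<Rightarrow> nat list \<Rightarrow> bool" where
  "is_block e s \<longleftrightarrow> s = [] \<or> length s + e \<le> last s"

fun dissectable :: "nat list \<Rightarrow> nat list \<Rightarrow> bool" where
  "dissectable [] mu \<longleftrightarrow> mu = []"
| "dissectable (e # es) mu \<longleftrightarrow> (\<exists>s t. mu = s @ t \<and> is_block e s \<and> dissectable es t)"

lemma is_block_Nil [simp]: "is_block e []"
  by (simp add: is_block_def)

lemma is_block_drop: "is_block e s \<Longrightarrow> is_block e (drop m s)"
  by (cases "m < length s") (auto simp: is_block_def last_drop)

lemma last_take_conv_nth:
  "take m s \<noteq> [] \<Longrightarrow> last (take m s) = s ! (min (length s) m - 1)"
  by (auto simp: last_conv_nth nth_take min_def)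

text \<open>Cutting off bottom rows cannot increase the height, and the new last row is at least as
  long as the old one because \<open>s\<close> is non-increasing.\<close>

lemma is_block_take:
  assumes "sorted_wrt (\<ge>) s" "is_block e s"
  shows "is_block e (take m s)"
proof (cases "take m s = []")
  case False
  then have "s \<noteq> []" "0 < m" by auto
  have "last (take m s) = s ! (min (length s) m - 1)"
    using False by (rule last_take_conv_nth)
  moreover have "s ! (length s - 1) \<le> s ! (min (length s) m - 1)"
  proof (cases "m < length s")
    case True
    then have "m - 1 < length s - 1" "length s - 1 < length s"
      using \<open>0 < m\<close> by auto
    then show ?thesis
      using sorted_wrt_nth_less[OF assms(1)] True by (simp add: min_def)
  qed (simp add: min_def)
  ultimately show ?thesis
    using assms(2) \<open>s \<noteq> []\<close> by (auto simp: is_block_def last_conv_nth)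
qed auto

lemma dissectable_Nil [simp]: "dissectable es []"
  by (induction es) auto

lemma dissectable_append:
  "dissectable (xs @ ys) mu \<longleftrightarrow> (\<exists>s t. mu = s @ t \<and> dissectable xs s \<and> dissectable ys t)"
proof (induction xs arbitrary: mu)
  case (Cons x xs)
  show ?case
    by (simp add: Cons.IH) (metis append.assoc)
qed simp

lemma dissectable_snoc:
  "dissectable (es @ [e]) mu \<longleftrightarrow> (\<exists>s t. mu = s @ t \<and> dissectable es s \<and> is_block e t)"
  by (simp add: dissectable_append)

lemma dissectable_drop: "dissectable es mu \<Longrightarrow> dissectable es (drop m mu)"
proof (induction es arbitrary: mu m)
  case (Cons e es)
  then obtain s t where st: "mu = s @ t" "is_block e s" "dissectable es t" by auto
  have "drop m mu = drop m s @ drop (m - length s) t" using st by simp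
  then show ?case
    using is_block_drop[OF st(2)] Cons.IH[OF st(3)] by auto
qed simp

lemma dissectable_take:
  "sorted_wrt (\<ge>) mu \<Longrightarrow> dissectable es mu \<Longrightarrow> dissectable es (take m mu)"
proof (induction es arbitrary: mu m)
  case (Cons e es)
  then obtain s t where st: "mu = s @ t" "is_block e s" "dissectable es t" by auto
  have sorted: "sorted_wrt (\<ge>) s" "sorted_wrt (\<ge>) t"
    using Cons.prems(1) st(1) by (auto simp: sorted_wrt_append)
  have "take m mu = take m s @ take (m - length s) t" using st by simp
  then show ?case
    using is_block_take[OF sorted(1) st(2)] Cons.IH[OF sorted(2) st(3)] by auto
qed simp

text \<open>The maximum unfolds to \<open>durfee_rect\<close> for \<open>e = 1\<close> and to
  \<open>durfee_sq\<close> for \<open>e = 0\<close>.\<close>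

definition remove_top_block :: "nat \<Rightarrow> nat list \<Rightarrow> nat list" where
  "remove_top_block e mu =
     drop (Max {c. c \<le> length mu \<and> (1 \<le> c \<longrightarrow> c + e \<le> mu ! (c - 1))}) mu"

definition remove_bottom_block :: "nat \<Rightarrow> nat list \<Rightarrow> nat list" where
  "remove_bottom_block e nu =
     (if nu = [] then [] else take (length nu - min (last nu - e) (length nu)) nu)"

text \<open>Any admissible first block \<open>s\<close> is at most as long as the greedy one, so the
  greedy step leaves a suffix of \<open>t\<close>, which inherits its cutting. Conversely, the
  greedy piece is itself a block.\<close>

lemma dissectable_Cons_iff_remove_top_block:
  "dissectable (e # es) mu \<longleftrightarrow> dissectable es (remove_top_block e mu)"
proof -
  define C where "C = {c. c \<le> length mu \<and> (1 \<le> c \<longrightarrow> c + e \<le> mu ! (c - 1))}"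
  \<comment> \<open>\<open>mu ! (c - 1)\<close> is the last of the top \<open>c\<close> rows; the
    guard \<open>1 \<le> c\<close> matches the empty block.\<close>
  have C_iff: "c \<in> C \<longleftrightarrow> c \<le> length mu \<and> is_block e (take c mu)" for c
  proof (cases "take c mu = []")
    case True
    then show ?thesis by (auto simp: C_def is_block_def)
  next
    case False
    then show ?thesis
      using last_take_conv_nth[OF False] by (auto simp: C_def is_block_def min_def)
  qed
  have "finite C" by (rule finite_subset[of _ "{..length mu}"]) (auto simp: C_def)
  have "0 \<in> C" by (simp add: C_def)
  have "Max C \<in> C" using \<open>finite C\<close> \<open>0 \<in> C\<close> by (intro Max_in) auto
  have top: "remove_top_block e mu = drop (Max C) mu"
    by (simp add: remove_top_block_def C_def)
  show ?thesis
  proof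
    assume "dissectable (e # es) mu"
    then obtain s t where st: "mu = s @ t" "is_block e s" "dissectable es t" by auto
    then have "length s \<in> C" by (simp add: C_iff)
    then have "length s \<le> Max C" using \<open>finite C\<close> by simp
    then have "drop (Max C) mu = drop (Max C - length s) t" using st by simp
    then show "dissectable es (remove_top_block e mu)"
      using dissectable_drop[OF st(3)] top by simp
  next
    assume "dissectable es (remove_top_block e mu)"
    moreover have "is_block e (take (Max C) mu)" using \<open>Max C \<in> C\<close> C_iff by blast
    ultimately show "dissectable (e # es) mu"
      unfolding top by (metis append_take_drop_id dissectable.simps(2))
  qed
qed

text \<open>A nonempty bottom block \<open>t\<close> shares its last row with \<open>nu\<close>, so
  its height is at most \<open>last nu - e\<close> and the greedy step removes all of it, leaving a
  prefix of \<open>s\<close>.\<close>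

lemma dissectable_snoc_iff_remove_bottom_block:
  assumes "sorted_wrt (\<ge>) nu"
  shows "dissectable (es @ [e]) nu \<longleftrightarrow> dissectable es (remove_bottom_block e nu)"
proof (cases "nu = []")
  case True
  then show ?thesis by (simp add: remove_bottom_block_def)
next
  case False
  define m where "m = length nu - min (last nu - e) (length nu)"
  have bottom: "remove_bottom_block e nu = take m nu"
    using False by (simp add: remove_bottom_block_def m_def)
  show ?thesis
  proof
    assume "dissectable (es @ [e]) nu"
    then obtain s t where st: "nu = s @ t" "dissectable es s" "is_block e t"
      by (auto simp: dissectable_snoc)
    have "m \<le> length s"
    proof (cases "t = []")
      case True
      then show ?thesis using st(1) by (simp add: m_def)
    next
      case False
      then have "last nu = last t" "length t + e \<le> last t"
        using st by (auto simp: is_block_def)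
      then show ?thesis using st(1) by (simp add: m_def)
    qed
    then have "take m nu = take m s" using st by simp
    moreover have "sorted_wrt (\<ge>) s" using assms st by (simp add: sorted_wrt_append)
    ultimately show "dissectable es (remove_bottom_block e nu)"
      using dissectable_take st(2) bottom by simp
  next
    assume "dissectable es (remove_bottom_block e nu)"
    moreover have "is_block e (drop m nu)"
    \<comment> \<open>Here \<open>m < length nu\<close> forces the truncated difference
      \<open>last nu - e\<close> to be positive, hence a true difference that bounds the height of
      the piece.\<close>
    proof (cases "m < length nu")
      case True
      then show ?thesis by (auto simp: is_block_def m_def last_drop)
    qed simp
    ultimately show "dissectable (es @ [e]) nu"
      unfolding dissectable_snoc bottom by (metis append_take_drop_id)
  qed
qed

lemma fold_remove_top_block_eq_Nil_iff:
  "fold remove_top_block es mu = [] \<longleftrightarrow> dissectable es mu"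
  by (induction es arbitrary: mu)
    (simp_all add: dissectable_Cons_iff_remove_top_block del: dissectable.simps(2))

lemma sorted_remove_bottom_block:
  "sorted_wrt (\<ge>) nu \<Longrightarrow> sorted_wrt (\<ge>) (remove_bottom_block e nu)"
  by (simp add: remove_bottom_block_def sorted_wrt_take)

text \<open>\<open>es\<close> lists the blocks from top to bottom, whereas the removal starts with
  the lowest one; hence \<open>rev es\<close>.\<close>

lemma fold_remove_bottom_block_eq_Nil_iff:
  "sorted_wrt (\<ge>) nu \<Longrightarrow> fold remove_bottom_block (rev es) nu = [] \<longleftrightarrow> dissectable es nu"
  by (induction es arbitrary: nu rule: rev_induct)
    (simp_all add: dissectable_snoc_iff_remove_bottom_block sorted_remove_bottom_block)

lemma durfee_dissection_conv_fold:
  "durfee_dissection k lam j =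
     fold remove_top_block (map (\<lambda>j. if j < k then 1 else 0) [0..<j]) lam"
  by (induction j)
    (simp_all add: Let_def remove_top_block_def durfee_rect_def durfee_sq_def Suc_le_eq)

lemma bottom_dissection_conv_fold:
  "bottom_dissection k lam j =
     fold remove_bottom_block (map (\<lambda>j. if j < k then 0 else 1) [0..<j]) lam"
  by (induction j)
    (simp_all add: Let_def remove_bottom_block_def remove_bottom_square_def
      remove_bottom_rect_def Suc_le_eq)

theorem theorem2p3:
  fixes r i :: nat
  assumes "2 \<le> r" and "1 \<le> i" and "i \<le> r"
  shows "bottom_set r i = durfee_set r i"
proof -
  define es :: "nat list" where "es = map (\<lambda>j. if j < r - i then 1 else 0) [0..<r - 1]"
  \<comment> \<open>Reversal sends position \<open>j\<close> to \<open>r - 2 - j\<close>, and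
    \<open>j < i - 1\<close> holds exactly when \<open>r - i \<le> r - 2 - j\<close>.\<close>
  have rev_es: "map (\<lambda>j. if j < i - 1 then 0 else 1) [0..<r - 1] = rev es"
    using assms by (intro nth_equalityI) (auto simp: es_def rev_nth)
  have "bottom_dissection (i - 1) lam (r - 1) = [] \<longleftrightarrow> durfee_dissection (r - i) lam (r - 1) = []"
    if "is_partition lam" for lam
    using that
    unfolding bottom_dissection_conv_fold durfee_dissection_conv_fold rev_es es_def[symmetric]
    by (simp add: is_partition_def fold_remove_top_block_eq_Nil_iff
        fold_remove_bottom_block_eq_Nil_iff)
  then show ?thesis
    by (auto simp: bottom_set_def durfee_set_def)
qed

end
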